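(* Let $d\mu$ be a nontrivial probability measure on $\partial\mathbb{D}$, let $n\ge 1$ and let $\beta\in\partial\mathbb{D}$. Let $(z_1,\dots,z_n)$ be the cyclicly ordered zeros of the paraorthogonal polynomial $\Phi_n(z,d\mu;\beta)$ and let $(w_1,\dots,w_n)$ be the cyclicly ordered zeros of $\Psi_n(z,d\mu;-\beta)$ (with parameter $-\beta$, not $\beta$). Then $(z_1,\dots,z_n)$ and $(w_1,\dots,w_n)$ strictly interlace.
   Context: $\mathbb{D}=\{z\in\mathbb{C}:|z|<1\}$ and $\partial\mathbb{D}=\{z\in\mathbb{C}:|z|=1\}$. A probability measure on $\partial\mathbb{D}$ is nontrivial if its support is infinite. Its monic orthogonal polynomials $\Phi_n(z)=\Phi_n(z,d\mu)$ (with $\Phi_0=1$) obey the Szegő recursion $\Phi_{n+1}(z)=z\Phi_n(z)-\bar\alpha_n\Phi_n^*(z)$, where $\Phi_n^*(z)=z^n\,\overline{\Phi_n(1/\bar z)}$ and $\alpha_n=\alpha_n(d\mu)\in\mathbb{D}$, $n\ge 0$, are the Verblunsky coefficients of $d\mu$; the map $d\mu\mapsto\{\alpha_n\}_{n=0}^\infty$ is a bijection from nontrivial probability measures onto $\mathbb{D}^\infty$. For $n\ge 1$ and $\beta\in\partial\mathbb{D}$, the paraorthogonal polynomial is $\Phi_n(z,d\mu;\beta)=z\Phi_{n-1}(z,d\mu)-\bar\beta\,\Phi_{n-1}^*(z,d\mu)$. The second kind polynomials $\Psi_n(z,d\mu)$ are the monic orthogonal polynomials obtained from the same recursion (with $\Psi_0=1$)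 with Verblunsky coefficients $-\alpha_j(d\mu)$ in place of $\alpha_j(d\mu)$, with $\Psi_n^*(z)=z^n\,\overline{\Psi_n(1/\bar z)}$, and $\Psi_n(z,d\mu;\beta)=z\Psi_{n-1}(z,d\mu)-\bar\beta\,\Psi_{n-1}^*(z,d\mu)$. Such degree-$n$ paraorthogonal polynomials have $n$ distinct zeros, all on $\partial\mathbb{D}$. For distinct $z,w\in\partial\mathbb{D}$, $(z,w)$ is the open arc of $\zeta\in\partial\mathbb{D}$ with $\mathrm{Arg}(z)<\mathrm{Arg}(\zeta)<\mathrm{Arg}(w)$, where the branch of $\mathrm{Arg}$ is chosen so that $0<\mathrm{Arg}(w)-\mathrm{Arg}(z)<2\pi$ (the counterclockwise arc from $z$ to $w$). Points $(z_1,\dots,z_\ell)$ (distinct) in $\partial\mathbb{D}$ are cyclicly ordered if none of the arcs $(z_j,z_{j+1})$, $1\le j\le\ell-1$, and $(z_\ell,z_1)$ contains any $z_k$. Two cyclicly ordered sets $(z_1,\dots,z_\ell)$ and $(w_1,\dots,w_\ell)$ strictly interlace if, after a cyclic permutation of the $w$'s, $w_j\in(z_j,z_{j+1})$ for $j=1,\dots,\ell-1$ and $w_\ell\in(z_\ell,z_1)$; when $\ell=1$ this is read as $w_1\ne z_1$. *)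

theory Defs
  imports "HOL-Probability.Probability" "HOL-Computational_Algebra.Polynomial"
begin

definition measure_support :: "complex measure \<Rightarrow> complex set" where
  "measure_support M = {z \<in> space M. \<forall>U. open U \<longrightarrow> z \<in> U \<longrightarrow> emeasure M (U \<inter> space M) > 0}"

definition nontrivial_circle_measure :: "complex measure \<Rightarrow> bool" where
  "nontrivial_circle_measure M \<longleftrightarrow>
     prob_space M \<and> sets M = sets (restrict_space borel (sphere (0::complex) 1)) \<and>
     infinite (measure_support M)"

definition is_monic_OP :: "complex measure \<Rightarrow> nat \<Rightarrow> complex poly \<Rightarrow> bool" where
  "is_monic_OP M n P \<longleftrightarrow>
     degree P = n \<and> lead_coeff P = 1 \<and> (\<forall>j<n. (LINT z|M. cnj (z ^ j) * poly P z) = 0)"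

definition Phi :: "complex measure \<Rightarrow> nat \<Rightarrow> complex poly" where
  "Phi M n = (THE P. is_monic_OP M n P)"

(* The reversal relative to the nominal degree n, given by coefficients so that it is a
   polynomial also at z = 0; poly_szego_star is the usual formula. *)
definition szego_star :: "nat \<Rightarrow> complex poly \<Rightarrow> complex poly" where
  "szego_star n P = (\<Sum>k\<le>n. monom (cnj (coeff P (n - k))) k)"

lemma poly_szego_star:
  assumes "degree P \<le> n" and "z \<noteq> 0"
  shows "poly (szego_star n P) z = z ^ n * cnj (poly P (1 / cnj z))"
proof -
  have "poly P (1 / cnj z) = (\<Sum>k\<le>n. coeff P k * (1 / cnj z) ^ k)"
    unfolding poly_altdef using assms(1)
    by (intro sum.mono_neutral_left) (auto simp: coeff_eq_0)
  then have "z ^ n * cnj (poly P (1 / cnj z)) = (\<Sum>k\<le>n. cnj (coeff P k) * z ^ (n - k))"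
    using assms(2)
    by (simp add: sum_distrib_left power_diff power_divide mult_ac)
  also have "\<dots> = (\<Sum>k\<le>n. cnj (coeff P (n - k)) * z ^ k)"
    by (rule sum.reindex_bij_witness[of _ "\<lambda>k. n - k" "\<lambda>k. n - k"]) auto
  finally show ?thesis
    by (simp add: szego_star_def poly_sum poly_monom)
qed

definition verblunsky :: "complex measure \<Rightarrow> nat \<Rightarrow> complex" where
  "verblunsky M n =
     (THE a. Phi M (Suc n) = pCons 0 (Phi M n) - smult (cnj a) (szego_star n (Phi M n)))"

fun szego_poly :: "(nat \<Rightarrow> complex) \<Rightarrow> nat \<Rightarrow> complex poly" where
  "szego_poly a 0 = 1"
| "szego_poly a (Suc n) =
     pCons 0 (szego_poly a n) - smult (cnj (a n)) (szego_star n (szego_poly a n))"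

definition Psi :: "complex measure \<Rightarrow> nat \<Rightarrow> complex poly" where
  "Psi M n = szego_poly (\<lambda>j. - verblunsky M j) n"

(* The two paraorthogonal families are meant for n \<ge> 1. *)
definition Phi_para :: "complex measure \<Rightarrow> nat \<Rightarrow> complex \<Rightarrow> complex poly" where
  "Phi_para M n \<beta> =
     pCons 0 (Phi M (n - 1)) - smult (cnj \<beta>) (szego_star (n - 1) (Phi M (n - 1)))"

definition Psi_para :: "complex measure \<Rightarrow> nat \<Rightarrow> complex \<Rightarrow> complex poly" where
  "Psi_para M n \<beta> =
     pCons 0 (Psi M (n - 1)) - smult (cnj \<beta>) (szego_star (n - 1) (Psi M (n - 1)))"

(* The reals a, t, b are the values of Arg at z, the point and w for a branch with
   0 < Arg w - Arg z < 2 pi; the arc is empty if z = w. *)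
definition circle_arc :: "complex \<Rightarrow> complex \<Rightarrow> complex set" where
  "circle_arc z w =
     {cis t | t a b. z = cis a \<and> w = cis b \<and> 0 < b - a \<and> b - a < 2 * pi \<and> a < t \<and> t < b}"

(* Tuples are lists; the index Suc j mod length zs makes the last arc run back to the
   first point. *)
definition cyclically_ordered :: "complex list \<Rightarrow> bool" where
  "cyclically_ordered zs \<longleftrightarrow>
     distinct zs \<and> set zs \<subseteq> sphere 0 1 \<and>
     (\<forall>j<length zs. \<forall>k<length zs. zs ! k \<notin> circle_arc (zs ! j) (zs ! (Suc j mod length zs)))"

definition strictly_interlace :: "complex list \<Rightarrow> complex list \<Rightarrow> bool" where
  "strictly_interlace zs ws \<longleftrightarrow>
     length ws = length zs \<and>
     (if length zs = 1 then ws ! 0 \<noteq> zs ! 0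
      else \<exists>r. \<forall>j<length zs.
             rotate r ws ! j \<in> circle_arc (zs ! j) (zs ! (Suc j mod length zs)))"

definition cyclically_ordered_zeros :: "complex poly \<Rightarrow> complex list \<Rightarrow> bool" where
  "cyclically_ordered_zeros P zs \<longleftrightarrow> cyclically_ordered zs \<and> set zs = {z. poly P z = 0}"

end

theory Submission
  imports Defs
begin

text \<open>
  Write \<open>P\<close> and \<open>Q\<close> for the two paraorthogonal polynomials, with \<open>n = N + 1\<close>. On the unit circle
  both satisfy a reversal symmetry, with opposite signs, which makes
  \<open>R = \<i> Q \<cdot> cnj P\<close> real-valued there. At a zero of \<open>P\<close>, the derivative of \<open>R\<close> in the angular
  variable is positive: it is determined by the product of the identity
  \<open>\<Psi> \<Phi>\<^sup>* + \<Phi> \<Psi>\<^sup>* = 2 z\<^sup>N \<Prod>(1 - |\<alpha>\<^sub>j|\<^sup>2)\<close> and of the positivity of the Wronskian of \<open>z \<Phi>\<close> and \<open>\<Phi>\<^sup>*\<close>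
  relative to \<open>z\<^sup>N\<close>, both of which follow by induction along the Szego recursion. So \<open>R\<close> is positive
  just after a zero of \<open>P\<close> and negative just before the next one, and \<open>Q\<close> vanishes in between.
  As there are as many arcs as zeros of \<open>Q\<close>, every arc contains exactly one of them, and a
  cyclic order argument shows that they are met in their cyclic order.
\<close>

section \<open>The cyclic order of the unit circle\<close>

lemma cis_eq_iff: "cis x = cis y \<longleftrightarrow> (\<exists>k::int. x = y + 2 * pi * k)"
proof -
  have "cis x = cis y \<longleftrightarrow> sin x = sin y \<and> cos x = cos y"
    by (auto simp: complex_eq_iff)
  also have "\<dots> \<longleftrightarrow> (\<exists>k::int. x = y + 2 * pi * k)"
    using sin_cos_eq_iff[of x y] by (simp add: algebra_simps)
  finally show ?thesis .
qed

lemma unit_circle_cis: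
  assumes "z \<in> sphere (0::complex) 1"
  obtains t where "0 \<le> t" "t < 2 * pi" "z = cis t"
proof
  show "z = cis (Arg2pi z)"
    using Arg2pi_eq[of z] assms by (simp add: cis_conv_exp)
qed (use Arg2pi_ge_0 Arg2pi_lt_2pi in auto)

lemma circle_arcI:
  assumes "a < t" "t < b" "b - a < 2 * pi"
  shows "cis t \<in> circle_arc (cis a) (cis b)"
proof -
  have "0 < b - a"
    using assms by linarith
  thus ?thesis
    unfolding circle_arc_def using assms by blast
qed

text \<open>Turns arc membership into comparisons of angles in [0, 2 pi). The three cases say where
  the jump of the angle lies: outside the arc, between \<open>a\<close> and \<open>b\<close>, or
  between \<open>b\<close> and \<open>c\<close>.\<close>

lemma cis_in_circle_arc_iff:
  assumes "0 \<le> a" "a < 2 * pi" "0 \<le> b" "b < 2 * pi" "0 \<le> c" "c < 2 * pi"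
  shows "cis b \<in> circle_arc (cis a) (cis c) \<longleftrightarrow>
    a < b \<and> b < c \<or> b < c \<and> c < a \<or> c < a \<and> a < b"
proof
  assume "cis b \<in> circle_arc (cis a) (cis c)"
  then obtain t a' c' where *: "cis b = cis t" "cis a = cis a'" "cis c = cis c'"
      "c' - a' < 2 * pi" "a' < t" "t < c'"
    unfolding circle_arc_def by blast
  obtain j k l :: int where "a' = a + 2 * pi * j" "t = b + 2 * pi * k" "c' = c + 2 * pi * l"
    using *(1-3) by (metis cis_eq_iff)
  \<comment> \<open>Only the numbers of turns relative to \<open>a'\<close> matter, and the bound on
    the arc length leaves just 0 and 1 for each.\<close>
  define p q where "p = k - j" and "q = l - j"
  have eqs: "t - a' = b - a + 2 * pi * p" "c' - a' = c - a + 2 * pi * q"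
    using \<open>a' = _\<close> \<open>t = _\<close> \<open>c' = _\<close> by (auto simp: p_def q_def algebra_simps)
  have ineqs: "0 < b - a + 2 * pi * p" "b - a + 2 * pi * p < c - a + 2 * pi * q"
      "c - a + 2 * pi * q < 2 * pi"
    using * eqs by linarith+
  have range: "r = 0 \<or> r = 1" if "0 < x + 2 * pi * r" "x + 2 * pi * r < 2 * pi" "\<bar>x\<bar> < 2 * pi"
    for x :: real and r :: int
  proof -
    have "(2 * pi) * (- 1) < (2 * pi) * r" "(2 * pi) * r < (2 * pi) * 2"
      using that by linarith+
    hence "(- 1 :: real) < r" "r < (2 :: real)"
      by (simp_all only: mult_less_cancel_left_pos pi_gt_zero zero_less_mult_iff zero_less_numeral simp_thms)
    thus ?thesis by linarith
  qed
  have "p = 0 \<or> p = 1" "q = 0 \<or> q = 1"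
    using range[of "b - a" p] range[of "c - a" q] ineqs assms by linarith+
  thus "a < b \<and> b < c \<or> b < c \<and> c < a \<or> c < a \<and> a < b"
    using ineqs assms by auto
next
  have per: "cis (x + 2 * pi) = cis x" for x
    by (simp add: complex_eq_iff)
  assume "a < b \<and> b < c \<or> b < c \<and> c < a \<or> c < a \<and> a < b"
  thus "cis b \<in> circle_arc (cis a) (cis c)"
    using circle_arcI[of a b c] circle_arcI[of a b "c + 2 * pi"]
      circle_arcI[of a "b + 2 * pi" "c + 2 * pi"] per assms
    by auto
qed

lemma circle_arc_in_sphere:
  assumes "y \<in> circle_arc x z"
  shows "x \<in> sphere 0 1" "y \<in> sphere 0 1" "z \<in> sphere 0 1"
  using assms by (auto simp: circle_arc_def)

text \<open>Read \<open>y \<in> circle_arc x z\<close> as "x, y, z in counterclockwise order". This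
  law and the next three are the axioms of a strict cyclic order, so the later combinatorics needs
  no angles.\<close>

lemma circle_arc_rotate:
  assumes "y \<in> circle_arc x z"
  shows "z \<in> circle_arc y x"
proof -
  note sph = circle_arc_in_sphere[OF assms]
  obtain a b c where "0 \<le> a" "a < 2 * pi" "x = cis a" "0 \<le> b" "b < 2 * pi" "y = cis b"
      "0 \<le> c" "c < 2 * pi" "z = cis c"
    using sph by (metis unit_circle_cis)
  thus ?thesis
    using assms by (auto simp: cis_in_circle_arc_iff)
qed

lemma circle_arc_asym:
  assumes "y \<in> circle_arc x z"
  shows "z \<notin> circle_arc x y"
proof -
  note sph = circle_arc_in_sphere[OF assms]
  obtain a b c where "0 \<le> a" "a < 2 * pi" "x = cis a" "0 \<le> b" "b < 2 * pi" "y = cis b"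
      "0 \<le> c" "c < 2 * pi" "z = cis c"
    using sph by (metis unit_circle_cis)
  thus ?thesis
    using assms by (auto simp: cis_in_circle_arc_iff)
qed

lemma circle_arc_trans:
  assumes "y \<in> circle_arc x z" "z \<in> circle_arc x w"
  shows "y \<in> circle_arc x w"
proof -
  note sph = circle_arc_in_sphere[OF assms(1)] circle_arc_in_sphere[OF assms(2)]
  obtain a b c d where "0 \<le> a" "a < 2 * pi" "x = cis a" "0 \<le> b" "b < 2 * pi" "y = cis b"
      "0 \<le> c" "c < 2 * pi" "z = cis c" "0 \<le> d" "d < 2 * pi" "w = cis d"
    using sph by (metis unit_circle_cis)
  thus ?thesis
    using assms by (auto simp: cis_in_circle_arc_iff)
qed

lemma circle_arc_total:
  assumes "x \<in> sphere 0 1" "y \<in> sphere 0 1" "z \<in> sphere 0 1" "x \<noteq> y" "y \<noteq> z" "x \<noteq> z"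
  shows "y \<in> circle_arc x z \<or> z \<in> circle_arc x y"
proof -
  obtain a b c where "0 \<le> a" "a < 2 * pi" "x = cis a" "0 \<le> b" "b < 2 * pi" "y = cis b"
      "0 \<le> c" "c < 2 * pi" "z = cis c"
    using assms by (metis unit_circle_cis)
  moreover from this assms have "a \<noteq> b" "b \<noteq> c" "a \<noteq> c"
    by auto
  ultimately show ?thesis
    by (auto simp: cis_in_circle_arc_iff)
qed

lemma circle_arc_ne:
  assumes "y \<in> circle_arc x z"
  shows "y \<noteq> x" "y \<noteq> z" "x \<noteq> z"
proof -
  have irrefl: "u \<notin> circle_arc u v" for u v
  proof
    assume u: "u \<in> circle_arc u v"
    obtain a c where "0 \<le> a" "a < 2 * pi" "u = cis a" "0 \<le> c" "c < 2 * pi" "v = cis c"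
      using circle_arc_in_sphere[OF u] by (metis unit_circle_cis)
    thus False
      using u by (auto simp: cis_in_circle_arc_iff)
  qed
  show "y \<noteq> x" "y \<noteq> z" "x \<noteq> z"
    using assms circle_arc_rotate[OF assms] circle_arc_rotate[OF circle_arc_rotate[OF assms]] irrefl
    by auto
qed

section \<open>Interlacing of cyclically ordered tuples\<close>

text \<open>Since \<open>zs ! k\<close> does not interrupt the arc that starts at
  \<open>zs ! j\<close>, this arc lies inside the one from \<open>zs ! j\<close> to
  \<open>zs ! k\<close>. By symmetry a common point would lie both between j and k and between k and
  j, against asymmetry.\<close>

lemma cyclically_ordered_arcs_disjoint:
  assumes "cyclically_ordered zs" "j < length zs" "k < length zs" "j \<noteq> k"
    "x \<in> circle_arc (zs ! j) (zs ! (Suc j mod length zs))"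
  shows "x \<notin> circle_arc (zs ! k) (zs ! (Suc k mod length zs))"
proof
  have *: "x \<in> circle_arc (zs ! j) (zs ! k)"
    if "j < length zs" "k < length zs" "j \<noteq> k"
      "x \<in> circle_arc (zs ! j) (zs ! (Suc j mod length zs))" for j k
  proof (cases "zs ! k = zs ! (Suc j mod length zs)")
    case False
    have "zs ! j \<noteq> zs ! k"
      using that assms(1) by (auto simp: cyclically_ordered_def nth_eq_iff_index_eq)
    moreover have "zs ! k \<notin> circle_arc (zs ! j) (zs ! (Suc j mod length zs))"
      using assms(1) that by (auto simp: cyclically_ordered_def)
    moreover have "zs ! k \<in> sphere 0 1"
      using assms(1) that(2) nth_mem unfolding cyclically_ordered_def by blast
    ultimately have "zs ! (Suc j mod length zs) \<in> circle_arc (zs ! j) (zs ! k)"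
      using circle_arc_total[of "zs ! j" "zs ! k" "zs ! (Suc j mod length zs)"] False
        circle_arc_in_sphere[OF that(4)] circle_arc_ne[OF that(4)] by auto
    with that(4) show ?thesis
      by (rule circle_arc_trans)
  qed (use that in auto)
  assume "x \<in> circle_arc (zs ! k) (zs ! (Suc k mod length zs))"
  with *[of k j] *[of j k] assms have "x \<in> circle_arc (zs ! k) (zs ! j)" "x \<in> circle_arc (zs ! j) (zs ! k)"
    by auto
  thus False
    by (meson circle_arc_asym circle_arc_rotate)
qed

text \<open>Pigeonhole: the arcs are disjoint and as many as the entries of \<open>ws\<close>, so
  each contains exactly one entry. The map from arcs to entries respects successors and is therefore
  a rotation.\<close>

lemma strictly_interlaceI:
  assumes zs: "cyclically_ordered zs" and ws: "cyclically_ordered ws"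
    and len: "length ws = length zs" "length zs \<ge> 2"
    and hit: "\<And>j. j < length zs \<Longrightarrow>
      \<exists>w\<in>set ws. w \<in> circle_arc (zs ! j) (zs ! (Suc j mod length zs))"
  shows "strictly_interlace zs ws"
proof -
  define n where "n = length zs"
  have "n > 0"
    using len(2) unfolding n_def by linarith
  define A where "A j = circle_arc (zs ! j) (zs ! (Suc j mod n))" for j
  have "\<exists>k<n. ws ! k \<in> A j" if "j < n" for j
    using hit[of j] that len unfolding A_def n_def by (metis in_set_conv_nth)
  then obtain s where s: "\<And>j. j < n \<Longrightarrow> s j < n" "\<And>j. j < n \<Longrightarrow> ws ! s j \<in> A j"
    by metis
  have disj: "j = k" if "j < n" "k < n" "x \<in> A j" "x \<in> A k" for j k x
    using cyclically_ordered_arcs_disjoint[OF zs, of j k x] that unfolding A_def n_def by blast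
  \<comment> \<open>Disjointness makes \<open>s\<close> injective, hence onto, so every entry of
    \<open>ws\<close> lies in an arc.\<close>
  have "inj_on s {..<n}"
    by (rule inj_onI) (metis disj lessThan_iff s(2))
  hence surj: "s ` {..<n} = {..<n}"
    using s(1) by (intro endo_inj_surj) auto
  have uniq: "k = s j" if "k < n" "j < n" "ws ! k \<in> A j" for j k
  proof -
    have "k \<in> s ` {..<n}"
      using surj that by simp
    then obtain l where "l < n" "k = s l"
      by auto
    thus ?thesis
      using disj[of l j "ws ! k"] that s(2) by auto
  qed
  have step: "s (Suc j mod n) = Suc (s j) mod n" if "j < n" for j
  proof -
    define i where "i = Suc j mod n"
    have i: "i < n" using \<open>n > 0\<close> by (simp add: i_def)
    have "i \<noteq> j"
      using that len unfolding i_def n_def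
      by (auto simp: mod_Suc)
    define m where "m = Suc (s j) mod n"
    have m: "m < n" using \<open>n > 0\<close> by (simp add: m_def)
    have "m \<noteq> s j"
      using s(1)[OF that] len unfolding m_def n_def
      by (auto simp: mod_Suc)
    define a b c where "a = zs ! j" and "b = zs ! i" and "c = zs ! (Suc i mod n)"
    define x y w where "x = ws ! s j" and "y = ws ! s i" and "w = ws ! m"
    have x: "x \<in> circle_arc a b" and y: "y \<in> circle_arc b c"
      using s(2)[OF that] s(2)[OF i] unfolding A_def a_def b_def c_def x_def y_def i_def by auto
    have "a \<notin> circle_arc b c"
      using zs that i unfolding cyclically_ordered_def a_def b_def c_def n_def by auto
    moreover have "a \<in> sphere 0 1" "b \<in> sphere 0 1" "c \<in> sphere 0 1" "a \<noteq> b" "b \<noteq> c"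
      using circle_arc_in_sphere[OF x] circle_arc_in_sphere[OF y] circle_arc_ne[OF x] circle_arc_ne[OF y]
      by auto
    \<comment> \<open>For \<open>n = 2\<close> the point \<open>c\<close> is \<open>a\<close>
      itself.\<close>
    ultimately have "a = c \<or> c \<in> circle_arc b a"
      using circle_arc_total[of b a c] by auto
    hence "y \<in> circle_arc b a"
      using circle_arc_trans[OF y] y by blast
    moreover have ax: "a \<in> circle_arc b x"
      using circle_arc_rotate[OF circle_arc_rotate[OF x]] .
    ultimately have "y \<in> circle_arc b x"
      by (rule circle_arc_trans)
    hence b: "b \<in> circle_arc x y"
      by (rule circle_arc_rotate[OF circle_arc_rotate])
    \<comment> \<open>Otherwise the successor \<open>w\<close> of \<open>x\<close> would precede
      \<open>y\<close>. Before \<open>b\<close> it would share an arc with \<open>x\<close>, after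
      \<open>b\<close> it would share one with \<open>y\<close>; either way that arc would hold two
      entries.\<close>
    have "w = y"
    proof (rule ccontr)
      assume "w \<noteq> y"
      have "w \<noteq> x"
        using \<open>m \<noteq> s j\<close> ws m s(1)[OF that] len unfolding w_def x_def cyclically_ordered_def n_def
        by (auto simp: nth_eq_iff_index_eq)
      have "w \<in> sphere 0 1"
        using ws m len(1) unfolding cyclically_ordered_def w_def n_def
        by (metis nth_mem subsetD)
      moreover have "y \<notin> circle_arc x w"
        using ws s(1)[OF that] s(1)[OF i] len
        unfolding cyclically_ordered_def x_def y_def w_def m_def n_def by auto
      ultimately have w: "w \<in> circle_arc x y"
        using circle_arc_total[of x w y] circle_arc_in_sphere[OF b] circle_arc_ne[OF b]
          \<open>w \<noteq> y\<close> \<open>w \<noteq> x\<close> by auto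
      have "m \<in> s ` {..<n}"
        using surj m by simp
      then obtain l where l: "l < n" "w \<in> A l"
        using s(2) unfolding w_def by auto
      have "w \<noteq> b"
        using l zs i unfolding cyclically_ordered_def A_def b_def n_def by auto
      hence "w \<in> circle_arc x b \<or> b \<in> circle_arc x w"
        using circle_arc_total[of x w b] \<open>w \<in> sphere 0 1\<close> \<open>w \<noteq> x\<close> circle_arc_in_sphere[OF b]
          circle_arc_ne[OF b] by auto
      thus False
      proof
        assume "w \<in> circle_arc x b"
        note circle_arc_trans[OF ax circle_arc_rotate[OF circle_arc_rotate[OF this]]]
        hence "w \<in> circle_arc a b"
          by (rule circle_arc_rotate)
        hence "w \<in> A j"
          by (simp add: A_def a_def b_def i_def)
        thus False
          using uniq[of m j] m that \<open>m \<noteq> s j\<close> unfolding w_def by blast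
      next
        assume "b \<in> circle_arc x w"
        hence "x \<in> circle_arc w b"
          by (rule circle_arc_rotate[OF circle_arc_rotate])
        with circle_arc_rotate[OF w] have "y \<in> circle_arc w b"
          by (rule circle_arc_trans)
        hence "w \<in> circle_arc b y"
          by (rule circle_arc_rotate[OF circle_arc_rotate])
        hence "w \<in> circle_arc b c"
          using y by (rule circle_arc_trans)
        hence "w \<in> A i"
          by (simp add: A_def b_def c_def)
        hence "m = s i"
          using uniq[of m i] m i unfolding w_def by blast
        thus False
          using \<open>w \<noteq> y\<close> unfolding w_def y_def by blast
      qed
    qed
    thus ?thesis
      using ws m s(1)[OF i] len unfolding w_def y_def cyclically_ordered_def n_def i_def m_def
      by (auto simp: nth_eq_iff_index_eq)
  qed
  have "s j = (s 0 + j) mod n" if "j < n" for j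
    using that
  proof (induction j)
    case (Suc j)
    thus ?case
      using step[of j] by (simp add: mod_Suc_eq)
  qed (use s(1) in auto)
  hence "rotate (s 0) ws ! j \<in> circle_arc (zs ! j) (zs ! (Suc j mod length zs))"
    if "j < length zs" for j
    using s(2)[of j] that len by (auto simp: nth_rotate n_def A_def)
  thus ?thesis
    using len unfolding strictly_interlace_def by auto
qed

section \<open>The Szego recursion on the unit circle\<close>

lemma coeff_szego_star:
  "coeff (szego_star n P) k = (if k \<le> n then cnj (coeff P (n - k)) else 0)"
  unfolding szego_star_def by (simp add: coeff_sum)

lemma degree_szego_star: "degree (szego_star n P) \<le> n"
  by (rule degree_le) (simp add: coeff_szego_star)

lemma cnj_power_cancel:
  assumes "norm z = 1"
  shows "z ^ n * cnj z ^ n = 1"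
proof -
  have "z * cnj z = 1"
    using complex_norm_square[of z] assms by simp
  thus ?thesis
    by (simp flip: power_mult_distrib)
qed

lemma one_minus_mult_cnj: "1 - z * cnj z = of_real (1 - (norm z)\<^sup>2)"
  unfolding of_real_diff complex_norm_square by simp

lemma poly_szego_star_unit:
  assumes "degree P \<le> n" "norm z = 1"
  shows "poly (szego_star n P) z = z ^ n * cnj (poly P z)"
proof -
  have "z \<noteq> 0" "1 / cnj z = z"
    using assms(2) cnj_power_cancel[of z 1] by (auto simp: divide_eq_eq)
  thus ?thesis
    using poly_szego_star[OF assms(1), of z] by simp
qed

lemma cnj_poly_szego_star_unit:
  assumes "degree P \<le> n" "norm z = 1"
  shows "z ^ n * cnj (poly (szego_star n P) z) = poly P z"
  using cnj_power_cancel[OF assms(2), of n] by (simp add: poly_szego_star_unit[OF assms])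

text \<open>Reversal of order \<open>Suc n\<close> is conjugate-linear and swaps
  \<open>pCons 0 P\<close> with \<open>szego_star n P\<close>. Comparing coefficients covers z = 0
  as well.\<close>

lemma szego_star_step:
  assumes "degree P \<le> n"
  shows "szego_star (Suc n) (pCons 0 P - smult c (szego_star n P)) =
    szego_star n P - smult (cnj c) (pCons 0 P)"
proof (rule poly_eqI)
  fix k
  show "coeff (szego_star (Suc n) (pCons 0 P - smult c (szego_star n P))) k =
      coeff (szego_star n P - smult (cnj c) (pCons 0 P)) k"
  proof (cases k)
    case 0
    thus ?thesis by (simp add: coeff_szego_star)
  next
    case (Suc m)
    show ?thesis
    proof (cases "k \<le> n")
      case True
      hence "n - m = Suc (n - k)" using Suc by simp
      thus ?thesis using Suc True
        by (simp add: coeff_szego_star)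
    next
      case False
      thus ?thesis using Suc assms
        by (auto simp: coeff_szego_star coeff_eq_0 le_Suc_eq)
    qed
  qed
qed

lemma degree_szego_poly: "degree (szego_poly a n) \<le> n"
proof (induction n)
  case (Suc n)
  thus ?case
    by (simp, intro degree_diff_le) (use degree_szego_star[of n] in
      \<open>auto intro: order.trans[OF degree_smult_le] le_SucI simp: degree_pCons_eq_if\<close>)
qed simp

lemma szego_star_szego_poly_Suc:
  "szego_star (Suc n) (szego_poly a (Suc n)) =
    szego_star n (szego_poly a n) - smult (a n) (pCons 0 (szego_poly a n))"
  using szego_star_step[OF degree_szego_poly, of n a "cnj (a n)"] by simp

lemma szego_second_kind_identity:
  fixes a :: "nat \<Rightarrow> complex"
  defines "\<Phi> \<equiv> szego_poly a" and "\<Psi> \<equiv> szego_poly (\<lambda>j. - a j)"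
  shows "poly (\<Psi> n) z * poly (szego_star n (\<Phi> n)) z + poly (\<Phi> n) z * poly (szego_star n (\<Psi> n)) z =
    2 * of_real (\<Prod>j<n. 1 - (norm (a j))\<^sup>2) * z ^ n"
proof (induction n)
  case 0
  thus ?case by (simp add: \<Phi>_def \<Psi>_def szego_star_def)
next
  case (Suc n)
  have "poly (\<Psi> (Suc n)) z * poly (szego_star (Suc n) (\<Phi> (Suc n))) z +
      poly (\<Phi> (Suc n)) z * poly (szego_star (Suc n) (\<Psi> (Suc n))) z =
    z * (1 - a n * cnj (a n)) * (poly (\<Psi> n) z * poly (szego_star n (\<Phi> n)) z +
      poly (\<Phi> n) z * poly (szego_star n (\<Psi> n)) z)"
    unfolding \<Phi>_def \<Psi>_def szego_star_szego_poly_Suc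
    unfolding szego_poly.simps
    by (simp add: algebra_simps)
  also note one_minus_mult_cnj
  finally show ?case
    unfolding Suc.IH by (simp add: mult_ac)
qed

text \<open>On the circle U V = z^(n+1) |V|^2, so positivity of \<open>s\<close> says that the
  argument of U / V increases with the angle. One recursion step turns \<open>s\<close> into |W|^2 +
  (1 - |a n|^2) s.\<close>

lemma szego_wronskian:
  fixes a :: "nat \<Rightarrow> complex"
  assumes z: "norm z = 1" and a: "\<And>j. norm (a j) < 1"
  defines "U \<equiv> \<lambda>n. pCons 0 (szego_poly a n)" and "V \<equiv> \<lambda>n. szego_star n (szego_poly a n)"
  shows "\<exists>s>0. z * (poly (pderiv (U n)) z * poly (V n) z - poly (U n) z * poly (pderiv (V n)) z) =
    of_real s * z ^ Suc n"
proof (induction n)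
  case 0
  show ?case
    by (rule exI[of _ 1]) (simp add: U_def V_def szego_star_def pderiv_pCons)
next
  case (Suc n)
  then obtain s where s: "s > 0" and
    IH: "z * (poly (pderiv (U n)) z * poly (V n) z - poly (U n) z * poly (pderiv (V n)) z) =
      of_real s * z ^ Suc n"
    by blast
  \<comment> \<open>\<open>W\<close> is the value of \<open>V (Suc n)\<close> at \<open>z\<close>;
    by reversal on the circle, \<open>U (Suc n)\<close> there is z^(n+2) times its
    conjugate.\<close>
  define W where "W = poly (V n) z - a n * poly (U n) z"
  define c where "c = 1 - (norm (a n))\<^sup>2"
  have "c > 0"
    using a[of n] by (simp add: c_def power_less_one_iff abs_square_less_1)
  have c: "1 - a n * cnj (a n) = of_real c"
    unfolding c_def by (rule one_minus_mult_cnj)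
  have U: "U (Suc n) = pCons 0 (U n - smult (cnj (a n)) (V n))"
    and V: "V (Suc n) = V n - smult (a n) (U n)"
    unfolding U_def V_def szego_star_szego_poly_Suc by simp_all
  have 1: "poly (U n) z - cnj (a n) * poly (V n) z = z ^ Suc n * cnj W"
  proof -
    have "z ^ Suc n * cnj (poly (V n) z) = poly (U n) z"
      using cnj_poly_szego_star_unit[OF degree_szego_poly z, of n a]
      by (simp add: U_def V_def mult_ac)
    moreover have "z ^ Suc n * cnj (poly (U n) z) = poly (V n) z"
      using poly_szego_star_unit[OF degree_szego_poly z, of n a] cnj_power_cancel[OF z, of 1]
      by (simp add: U_def V_def mult_ac)
    ultimately show ?thesis
      by (simp add: W_def algebra_simps)
  qed
  have "z * (poly (pderiv (U (Suc n))) z * poly (V (Suc n)) z -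
      poly (U (Suc n)) z * poly (pderiv (V (Suc n))) z) =
    z * (poly (U n) z - cnj (a n) * poly (V n) z) * W + z * (1 - a n * cnj (a n)) *
      (z * (poly (pderiv (U n)) z * poly (V n) z - poly (U n) z * poly (pderiv (V n)) z))"
    unfolding U V W_def by (simp add: pderiv_pCons pderiv_diff pderiv_smult algebra_simps)
  also have "\<dots> = z * (z ^ Suc n * cnj W) * W + z * of_real c * (of_real s * z ^ Suc n)"
    unfolding 1 c IH ..
  also have "\<dots> = (W * cnj W + of_real (c * s)) * z ^ Suc (Suc n)"
    by (simp add: algebra_simps)
  also have "W * cnj W + of_real (c * s) = of_real ((norm W)\<^sup>2 + c * s)"
    unfolding of_real_add complex_norm_square ..
  finally show ?case
    using \<open>c > 0\<close> s by (intro exI[of _ "(norm W)\<^sup>2 + c * s"]) (simp add: add_nonneg_pos)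
qed

section \<open>Paraorthogonal polynomials on the unit circle\<close>

text \<open>Common form of \<open>Phi_para\<close> and \<open>Psi_para\<close>; here
  \<open>n\<close> is the order of the reversal, one less than the index used there.\<close>

definition para :: "nat \<Rightarrow> complex poly \<Rightarrow> complex \<Rightarrow> complex poly" where
  "para n P \<beta> = pCons 0 P - smult (cnj \<beta>) (szego_star n P)"

text \<open>On the circle, conjugating and multiplying by \<open>z ^ Suc n\<close> swaps z P and P*.
  As \<beta> is unimodular, the combination reproduces itself up to the factor -\<beta>.\<close>

lemma para_cnj:
  assumes "degree P \<le> n" "norm z = 1" "norm \<beta> = 1"
  shows "z ^ Suc n * cnj (poly (para n P \<beta>) z) = - \<beta> * poly (para n P \<beta>) z"
proof -
  have "z ^ Suc n * cnj (poly (para n P \<beta>) z) =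
      (z * cnj z) * (z ^ n * cnj (poly P z)) - \<beta> * z * (z ^ n * cnj (poly (szego_star n P) z))"
    by (simp add: para_def algebra_simps)
  also have "\<dots> = (\<beta> * cnj \<beta>) * poly (szego_star n P) z - \<beta> * z * poly P z"
    using cnj_power_cancel[of z 1] cnj_power_cancel[of \<beta> 1] assms
      poly_szego_star_unit[OF assms(1,2)] cnj_poly_szego_star_unit[OF assms(1,2)] by simp
  finally show ?thesis
    by (simp add: para_def algebra_simps)
qed

text \<open>The parameters \<beta> and -\<beta> give the symmetry opposite signs, so Q times the
  conjugate of P is purely imaginary.\<close>

lemma para_mult_cnj_para_Reals:
  assumes "degree P \<le> n" "degree Q \<le> n" "norm z = 1" "norm \<beta> = 1"
  shows "\<i> * poly (para n Q (- \<beta>)) z * cnj (poly (para n P \<beta>) z) \<in> \<real>"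
proof -
  define p q where "p = poly (para n P \<beta>) z" and "q = poly (para n Q (- \<beta>)) z"
  define Z where "Z = z ^ Suc n"
  have "Z * cnj p = - \<beta> * p" "Z * cnj q = \<beta> * q"
    using para_cnj[OF assms(1,3,4)] para_cnj[OF assms(2,3), of "- \<beta>"] assms(4)
    by (simp_all add: p_def q_def Z_def del: power_Suc)
  hence "(Z * cnj q) * p + q * (Z * cnj p) = 0"
    by simp
  hence "Z * (cnj q * p + q * cnj p) = 0"
    by (simp add: algebra_simps)
  moreover have "Z \<noteq> 0"
    using assms(3) by (auto simp: Z_def)
  ultimately have "cnj q * p = - (q * cnj p)"
    by (simp add: eq_neg_iff_add_eq_0)
  thus ?thesis
    unfolding p_def[symmetric] q_def[symmetric] Reals_cnj_iff by (simp add: mult_ac)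
qed

text \<open>The second quantity is the angular derivative of \<i> Q cnj P at a zero of P, where the
  other term of the product rule vanishes. Multiplied by \<open>v\<close>, both z P' and Q become
  positive multiples of \<open>z ^ Suc n\<close>, whose phases cancel.\<close>

lemma para_zero_residue:
  fixes a :: "nat \<Rightarrow> complex"
  assumes z: "norm z = 1" and a: "\<And>j. norm (a j) < 1"
    and P_def: "P = para n (szego_poly a n) \<beta>"
    and Q_def: "Q = para n (szego_poly (\<lambda>j. - a j) n) (- \<beta>)"
    and zero: "poly P z = 0"
  shows "poly Q z \<noteq> 0" "Re (\<i> * poly Q z * cnj (\<i> * z * poly (pderiv P) z)) > 0"
proof -
  define U V where "U = pCons 0 (szego_poly a n)" and "V = szego_star n (szego_poly a n)"
  define v where "v = poly V z"
  define \<omega> where "\<omega> = (\<Prod>j<n. 1 - (norm (a j))\<^sup>2)"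
  obtain s where s: "s > 0" "z * (poly (pderiv U) z * poly V z - poly U z * poly (pderiv V) z) =
    of_real s * z ^ Suc n"
    using szego_wronskian[of z a n, folded U_def V_def] z a by metis
  have "\<omega> > 0"
    using a unfolding \<omega>_def by (intro prod_pos) (simp add: abs_square_less_1)
  have "cnj \<beta> * v = poly U z"
    using zero by (simp add: P_def para_def U_def V_def v_def)
  have "z * poly (pderiv P) z * v =
      z * (poly (pderiv U) z * v - (cnj \<beta> * v) * poly (pderiv V) z)"
    unfolding P_def para_def U_def[symmetric] V_def[symmetric]
    by (simp add: pderiv_diff pderiv_smult algebra_simps)
  also have "\<dots> = of_real s * z ^ Suc n"
    unfolding \<open>cnj \<beta> * v = poly U z\<close> s(2)[symmetric] by (simp add: v_def)
  finally have P': "z * poly (pderiv P) z * v = of_real s * z ^ Suc n" .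
  \<comment> \<open>Here the parameter -\<beta> matters: it puts a plus sign before \<Psi>*, and
    replacing \<open>cnj \<beta> * v\<close> by z \<Phi> yields the second kind identity.\<close>
  have "poly Q z * v = z * (poly (szego_poly (\<lambda>j. - a j) n) z * v) +
      poly (szego_star n (szego_poly (\<lambda>j. - a j) n)) z * (cnj \<beta> * v)"
    by (simp add: Q_def para_def algebra_simps)
  also have "\<dots> = z * (2 * of_real \<omega> * z ^ n)"
    unfolding \<open>cnj \<beta> * v = poly U z\<close> \<omega>_def szego_second_kind_identity[symmetric]
    by (simp add: U_def v_def V_def algebra_simps)
  finally have Q: "poly Q z * v = 2 * of_real \<omega> * z ^ Suc n"
    by (simp add: mult_ac)
  have "z \<noteq> 0"
    using z by auto
  with Q \<open>\<omega> > 0\<close> show "poly Q z \<noteq> 0"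
    by auto
  have "v \<noteq> 0"
    using Q \<open>\<omega> > 0\<close> \<open>z \<noteq> 0\<close> by auto
  define X where "X = \<i> * poly Q z * cnj (\<i> * z * poly (pderiv P) z)"
  have "X = (\<i> * cnj \<i>) * (poly Q z * cnj (z * poly (pderiv P) z))"
    by (simp only: X_def complex_cnj_mult mult_ac)
  hence "X * of_real ((norm v)\<^sup>2) = (poly Q z * v) * cnj (z * poly (pderiv P) z * v)"
    unfolding complex_norm_square by simp
  also have "\<dots> = 2 * of_real \<omega> * of_real s * (z ^ Suc n * cnj z ^ Suc n)"
    unfolding P' Q by simp
  also have "\<dots> = of_real (2 * \<omega> * s)"
    unfolding cnj_power_cancel[OF z] by simp
  finally have "X = of_real (2 * \<omega> * s / (norm v)\<^sup>2)"
    using \<open>v \<noteq> 0\<close> by (simp add: field_simps)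
  thus "Re (\<i> * poly Q z * cnj (\<i> * z * poly (pderiv P) z)) > 0"
    using \<open>\<omega> > 0\<close> s(1) \<open>v \<noteq> 0\<close> unfolding X_def[symmetric] by simp
qed

lemma zero_between_para_zeros:
  fixes a :: "nat \<Rightarrow> complex"
  assumes a: "\<And>j. norm (a j) < 1" and \<beta>: "norm \<beta> = 1"
    and P_def: "P = para n (szego_poly a n) \<beta>"
    and Q_def: "Q = para n (szego_poly (\<lambda>j. - a j) n) (- \<beta>)"
    and less: "s < t" and zeros: "poly P (cis s) = 0" "poly P (cis t) = 0"
    and gap: "\<And>u. s < u \<Longrightarrow> u < t \<Longrightarrow> poly P (cis u) \<noteq> 0"
  shows "\<exists>u. s < u \<and> u < t \<and> poly Q (cis u) = 0"
proof -
  define R where "R u = Re (\<i> * poly Q (cis u) * cnj (poly P (cis u)))" for u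
  have deriv: "(R has_real_derivative
      Re (\<i> * (poly Q (cis u) * cnj (\<i> * cis u * poly (pderiv P) (cis u))
        + \<i> * cis u * poly (pderiv Q) (cis u) * cnj (poly P (cis u))))) (at u)" for u
  proof -
    have cis: "(cis has_vector_derivative \<i> * cis u) (at u)"
      by (rule has_vector_derivative_eq_rhs)
         (auto simp: has_vector_derivative_def scaleR_conv_of_real intro!: derivative_eq_intros)
    have pc: "((\<lambda>u. poly p (cis u)) has_vector_derivative \<i> * cis u * poly (pderiv p) (cis u)) (at u)"
      for p :: "complex poly"
      using field_vector_diff_chain_at[OF cis poly_DERIV[of p]] by (simp add: o_def)
    show ?thesis
      unfolding R_def has_real_derivative_iff_has_vector_derivative
      using bounded_linear.has_vector_derivative[OF bounded_linear_Re
         has_vector_derivative_mult_right[OF has_vector_derivative_mult[OF pc[of Q]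
         bounded_linear.has_vector_derivative[OF bounded_linear_cnj pc[of P]]], of \<i>]]
      by (simp add: mult.assoc)
  qed
  have pos: "\<exists>l>0. (R has_real_derivative l) (at u)" if "poly P (cis u) = 0" for u
    using para_zero_residue(2)[OF _ a P_def Q_def that] deriv[of u] that
    by (auto simp: mult.assoc)
  have R0: "R u = 0" if "poly P (cis u) = 0" for u
    using that by (simp add: R_def)
  obtain d e where d: "d > 0" "\<And>h. 0 < h \<Longrightarrow> h < d \<Longrightarrow> R s < R (s + h)"
    and e: "e > 0" "\<And>h. 0 < h \<Longrightarrow> h < e \<Longrightarrow> R (t - h) < R t"
    using pos[OF zeros(1)] pos[OF zeros(2)] DERIV_pos_inc_right DERIV_pos_inc_left by metis
  \<comment> \<open>Half of \<open>d\<close> and \<open>e\<close> keeps \<open>h\<close> strictly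
    below both; half of the gap keeps \<open>s + h\<close> to the left of
    \<open>t - h\<close>.\<close>
  define h where "h = min (min (d / 2) (e / 2)) ((t - s) / 2)"
  have "h > 0" "h \<le> d / 2" "h \<le> e / 2" "h \<le> (t - s) / 2"
    using d(1) e(1) less unfolding h_def by (simp, meson min.cobounded1 min.cobounded2 order.trans)+
  hence h: "0 < h" "h < d" "h < e" "s + h \<le> t - h"
    using d(1) e(1) by (auto simp: field_simps)
  have "continuous_on {s + h..t - h} R"
    by (intro continuous_at_imp_continuous_on ballI) (rule DERIV_isCont[OF deriv])
  moreover have "R (t - h) \<le> 0" "0 \<le> R (s + h)"
    using d(2)[of h] e(2)[of h] h R0[OF zeros(1)] R0[OF zeros(2)] by auto
  ultimately obtain u where u: "s + h \<le> u" "u \<le> t - h" "R u = 0"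
    using IVT2'[of R "t - h" 0 "s + h"] h by auto
  \<comment> \<open>\<open>R\<close> is only a real part; reality of the product upgrades its zero
    to a zero of the product itself.\<close>
  have "\<i> * poly Q (cis u) * cnj (poly P (cis u)) \<in> \<real>"
    unfolding P_def Q_def by (intro para_mult_cnj_para_Reals degree_szego_poly \<beta>) simp
  with u(3) have "\<i> * poly Q (cis u) * cnj (poly P (cis u)) = 0"
    unfolding R_def by (metis Re_complex_of_real Reals_cases of_real_0)
  hence "poly Q (cis u) = 0"
    using gap[of u] u h by auto
  thus ?thesis
    using u h by (intro exI[of _ u]) auto
qed

section \<open>Monic orthogonal polynomials of a nontrivial measure\<close>

locale circle_measure =
  fixes M :: "complex measure"
  assumes nontrivial: "nontrivial_circle_measure M"

sublocale circle_measure \<subseteq> prob_space M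
  using nontrivial by (simp add: nontrivial_circle_measure_def)

context circle_measure
begin

lemma sets_M: "sets M = sets (restrict_space borel (sphere 0 1))"
  using nontrivial by (simp add: nontrivial_circle_measure_def)

lemma space_M: "space M = sphere 0 1"
  using sets_eq_imp_space_eq[OF sets_M] by (simp add: space_restrict_space)

lemma borel_measurable_continuous:
  fixes f :: "complex \<Rightarrow> complex"
  assumes "continuous_on UNIV f"
  shows "f \<in> borel_measurable M"
  using measurable_restrict_space1[OF borel_measurable_continuous_onI[OF assms], of "sphere 0 1"]
  by (simp add: measurable_cong_sets[OF sets_M refl])

lemma integrable_continuous:
  fixes f :: "complex \<Rightarrow> complex"
  assumes "continuous_on UNIV f"
  shows "integrable M f"
proof -
  have "compact (f ` sphere 0 1)"
    by (intro compact_continuous_image continuous_on_subset[OF assms]) auto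
  then obtain B where "\<And>z. z \<in> sphere 0 1 \<Longrightarrow> norm (f z) \<le> B"
    by (metis compact_imp_bounded bounded_iff imageI)
  thus ?thesis
    by (intro integrable_const_bound[of _ B] borel_measurable_continuous assms AE_I2)
       (simp add: space_M)
qed

section \<open>The inner product on polynomials\<close>

text \<open>Conjugate-linear in the first argument, to match the integrals in
  \<open>is_monic_OP\<close>.\<close>

definition ip :: "complex poly \<Rightarrow> complex poly \<Rightarrow> complex" where
  "ip P Q = (LINT z|M. cnj (poly P z) * poly Q z)"

lemma ip_integrable: "integrable M (\<lambda>z. cnj (poly P z) * poly Q z)"
  by (intro integrable_continuous continuous_intros)

lemma ip_commute: "ip P Q = cnj (ip Q P)"
proof -
  have "ip P Q = (LINT z|M. cnj (cnj (poly Q z) * poly P z))"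
    unfolding ip_def by (simp add: mult.commute)
  also have "\<dots> = cnj (ip Q P)"
    unfolding ip_def by (rule Bochner_Integration.integral_cnj)
  finally show ?thesis .
qed

lemma ip_add_right: "ip P (Q + R) = ip P Q + ip P R"
  unfolding ip_def using ip_integrable by (simp add: algebra_simps flip: Bochner_Integration.integral_add)

lemma ip_smult_right: "ip P (smult c Q) = c * ip P Q"
  unfolding ip_def by (subst integral_mult_right_zero[symmetric]) (simp add: mult_ac)

lemma ip_diff_right: "ip P (Q - R) = ip P Q - ip P R"
  using ip_add_right[of P Q "smult (- 1) R"] ip_smult_right[of P "- 1" R] by simp

lemma ip_add_left: "ip (P + Q) R = ip P R + ip Q R"
  by (subst (1 2 3) ip_commute) (simp add: ip_add_right)

lemma ip_smult_left: "ip (smult c P) Q = cnj c * ip P Q"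
  by (subst (1 2) ip_commute) (simp add: ip_smult_right)

lemma ip_eqI:
  assumes "\<And>z. norm z = 1 \<Longrightarrow>
    cnj (poly P z) * poly Q z = cnj (poly R z) * poly S z"
  shows "ip P Q = ip R S"
  unfolding ip_def using assms by (intro Bochner_Integration.integral_cong) (auto simp: space_M)

lemma ip_self: "ip P P = of_real (LINT z|M. (norm (poly P z))\<^sup>2)"
  unfolding ip_def by (subst integral_complex_of_real[symmetric])
    (simp only: complex_norm_square mult.commute)

text \<open>If the norm were zero, P would vanish almost everywhere. But P has finitely many zeros
  and the support is infinite, so the open set where P is nonzero contains a support point and has
  positive measure.\<close>

lemma ip_self_pos:
  assumes "P \<noteq> 0"
  shows "0 < (LINT z|M. (norm (poly P z))\<^sup>2)"
proof -
  have int: "integrable M (\<lambda>z. (norm (poly P z))\<^sup>2)"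
  proof -
    have "integrable M (\<lambda>z. Re (cnj (poly P z) * poly P z))"
      by (intro integrable_Re ip_integrable)
    also have "(\<lambda>z. Re (cnj (poly P z) * poly P z)) = (\<lambda>z. (norm (poly P z))\<^sup>2)"
      unfolding cmod_power2 by (simp add: power2_eq_square)
    finally show ?thesis .
  qed
  have "(LINT z|M. (norm (poly P z))\<^sup>2) \<noteq> 0"
  proof
    assume "(LINT z|M. (norm (poly P z))\<^sup>2) = 0"
    hence AE: "AE z in M. poly P z = 0"
      using int by (simp add: integral_nonneg_eq_0_iff_AE)
    have "infinite (measure_support M)"
      using nontrivial by (simp add: nontrivial_circle_measure_def)
    hence "\<not> measure_support M \<subseteq> {z. poly P z = 0}"
      using poly_roots_finite[OF assms] finite_subset by blast
    then obtain w where w: "w \<in> measure_support M" "poly P w \<noteq> 0"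
      by blast
    define U where "U = {z. poly P z \<noteq> 0}"
    have "open U"
      unfolding U_def by (intro open_Collect_neq continuous_intros)
    hence "emeasure M (U \<inter> space M) > 0"
      using w by (auto simp: measure_support_def U_def)
    moreover have "U \<inter> space M \<in> sets M"
      using \<open>open U\<close> unfolding sets_M space_M by (auto simp: sets_restrict_space)
    hence "emeasure M (U \<inter> space M) = 0"
      using AE by (subst (asm) AE_iff_measurable[of "U \<inter> space M"]) (auto simp: U_def)
    ultimately show False
      by simp
  qed
  moreover have "0 \<le> (LINT z|M. (norm (poly P z))\<^sup>2)"
    by simp
  ultimately show ?thesis
    by linarith
qed

section \<open>Monic orthogonal polynomials and Verblunsky coefficients\<close>

lemma is_monic_OP_ip:
  assumes "is_monic_OP M n P" "degree R < n"
  shows "ip R P = 0"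
proof -
  have "ip R P = (LINT z|M. (\<Sum>k\<le>degree R. cnj (coeff R k) * (cnj (z ^ k) * poly P z)))"
    unfolding ip_def poly_altdef[of R] by (simp add: sum_distrib_right mult.assoc)
  also have "\<dots> = (\<Sum>k\<le>degree R. LINT z|M. cnj (coeff R k) * (cnj (z ^ k) * poly P z))"
    by (intro Bochner_Integration.integral_sum integrable_continuous continuous_intros)
  also have "\<dots> = (\<Sum>k\<le>degree R. cnj (coeff R k) * (LINT z|M. cnj (z ^ k) * poly P z))"
    by (simp only: integral_mult_right_zero)
  also have "\<dots> = 0"
    using assms by (intro sum.neutral) (auto simp: is_monic_OP_def)
  finally show ?thesis .
qed

lemma degree_diff_monic_less:
  assumes "degree P = n" "lead_coeff P = 1" "degree Q = n" "lead_coeff Q = (1::complex)"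
    "P \<noteq> Q"
  shows "degree (P - Q) < n"
  using eq_zero_or_degree_less[of "P - Q" n] degree_diff_le[of P n Q] assms by auto

text \<open>The difference has degree below n, so it is orthogonal to both polynomials and thus to
  itself.\<close>

lemma is_monic_OP_unique:
  assumes P: "is_monic_OP M n P" and Q: "is_monic_OP M n Q"
  shows "P = Q"
proof (rule ccontr)
  assume "P \<noteq> Q"
  hence "degree (P - Q) < n"
    using assms by (intro degree_diff_monic_less) (auto simp: is_monic_OP_def)
  hence "ip (P - Q) (P - Q) = 0"
    unfolding ip_diff_right using is_monic_OP_ip[OF P] is_monic_OP_ip[OF Q] by simp
  thus False
    using ip_self_pos[of "P - Q"] \<open>P \<noteq> Q\<close> unfolding ip_self by simp
qed

text \<open>On the circle P* is \<open>z ^ n\<close> times the conjugate of P. The identity shows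
  that P* is orthogonal to z, ..., z^n.\<close>

lemma is_monic_OP_ip_monom:
  assumes P: "is_monic_OP M n P" and "j \<le> n"
  shows "ip (monom 1 j) (szego_star n P) = ip P (monom 1 (n - j))"
proof (rule ip_eqI)
  fix z :: complex assume z: "norm z = 1"
  have "z ^ n = z ^ j * z ^ (n - j)"
    using \<open>j \<le> n\<close> by (simp flip: power_add)
  thus "cnj (poly (monom 1 j) z) * poly (szego_star n P) z =
      cnj (poly P z) * poly (monom 1 (n - j)) z"
    using P cnj_power_cancel[OF z, of j] z
    by (subst poly_szego_star_unit) (auto simp: poly_monom is_monic_OP_def mult_ac)
qed

text \<open>Both z P and P* are orthogonal to z, ..., z^n, so one coefficient suffices to achieve
  orthogonality to 1 as well. The bound on it is Pythagoras: z P and P* have the norm of P, and the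
  new polynomial is orthogonal to P*.\<close>

lemma is_monic_OP_step:
  assumes P: "is_monic_OP M n P"
  shows "\<exists>a. norm a < 1 \<and>
    is_monic_OP M (Suc n) (pCons 0 P - smult (cnj a) (szego_star n P))"
proof -
  have deg: "degree P = n" and lead: "coeff P n = 1"
    using P by (auto simp: is_monic_OP_def)
  have "P \<noteq> 0"
    using lead by auto
  define N where "N = (LINT z|M. (norm (poly P z))\<^sup>2)"
  have "N > 0"
    unfolding N_def by (rule ip_self_pos) fact
  have N: "ip P P = of_real N"
    by (simp add: N_def ip_self)
  \<comment> \<open>The inner product of 1 and P* is the squared norm of P, because z^n - P has
    lower degree or is zero.\<close>
  have "ip P (monom 1 n) = ip P P + ip P (monom 1 n - P)"
    by (simp add: ip_diff_right)
  also have "ip P (monom 1 n - P) = 0"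
  proof (cases "P = monom 1 n")
    case False
    hence "degree (monom 1 n - P) < n"
      using deg lead by (intro degree_diff_monic_less) (auto simp: degree_monom_eq)
    thus ?thesis
      using is_monic_OP_ip[OF P] ip_commute[of P "monom 1 n - P"] by simp
  qed (simp add: ip_def)
  finally have star1: "ip (monom 1 0) (szego_star n P) = of_real N"
    using is_monic_OP_ip_monom[OF P, of 0] N by simp
  \<comment> \<open>Solves the equation for orthogonality to 1; the denominator is the inner product
    of 1 and P*.\<close>
  define a where "a = cnj (ip (monom 1 0) (pCons 0 P) / of_real N)"
  define Q where "Q = pCons 0 P - smult (cnj a) (szego_star n P)"
  have "degree (smult (cnj a) (szego_star n P)) \<le> n"
    using degree_smult_le degree_szego_star order.trans by blast
  hence "coeff (smult (cnj a) (szego_star n P)) (Suc n) = 0" "degree Q \<le> Suc n"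
    using deg by (auto simp: Q_def coeff_szego_star degree_pCons_eq_if intro!: degree_diff_le)
  hence "coeff Q (Suc n) = 1" "degree Q \<le> Suc n"
    by (auto simp: Q_def lead)
  hence degQ: "degree Q = Suc n" "lead_coeff Q = 1"
    using le_degree[of Q "Suc n"] by auto
  have orth: "ip (monom 1 j) Q = 0" if "j < Suc n" for j
  proof (cases j)
    case 0
    thus ?thesis
      using \<open>N > 0\<close> star1 by (simp add: Q_def ip_diff_right ip_smult_right a_def)
  next
    case (Suc i)
    have "ip (monom 1 j) (pCons 0 P) = ip (monom 1 i) P"
    proof (rule ip_eqI)
      fix z :: complex assume "norm z = 1"
      thus "cnj (poly (monom 1 j) z) * poly (pCons 0 P) z = cnj (poly (monom 1 i) z) * poly P z"
        using cnj_power_cancel[of z 1] by (simp add: Suc poly_monom mult_ac)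
    qed
    also have "\<dots> = 0"
      using that Suc by (intro is_monic_OP_ip[OF P]) (simp add: degree_monom_eq)
    finally have "ip (monom 1 j) (pCons 0 P) = 0" .
    moreover have "ip (monom 1 j) (szego_star n P) = 0"
      using that Suc is_monic_OP_ip[OF P, of "monom 1 (n - j)"] ip_commute[of P "monom 1 (n - j)"]
      by (simp add: is_monic_OP_ip_monom[OF P] degree_monom_eq)
    ultimately show ?thesis
      by (simp add: Q_def ip_diff_right ip_smult_right)
  qed
  hence Q: "is_monic_OP M (Suc n) Q"
    using degQ by (simp add: is_monic_OP_def ip_def poly_monom)
  define N' where "N' = (LINT z|M. (norm (poly Q z))\<^sup>2)"
  have "N' > 0"
    unfolding N'_def using degQ by (intro ip_self_pos) auto
  have QS: "ip (szego_star n P) Q = 0"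
    using degree_szego_star[of n P] by (intro is_monic_OP_ip[OF Q]) simp
  have "ip (pCons 0 P) (pCons 0 P) = ip P P"
  proof (rule ip_eqI)
    fix z :: complex assume "norm z = 1"
    thus "cnj (poly (pCons 0 P) z) * poly (pCons 0 P) z = cnj (poly P z) * poly P z"
      using cnj_power_cancel[of z 1] by (simp add: mult_ac)
  qed
  moreover have "ip (szego_star n P) (szego_star n P) = ip P P"
  proof (rule ip_eqI)
    fix z :: complex assume z: "norm z = 1"
    show "cnj (poly (szego_star n P) z) * poly (szego_star n P) z = cnj (poly P z) * poly P z"
      using cnj_power_cancel[OF z, of n] z deg by (simp add: poly_szego_star_unit mult_ac)
  qed
  \<comment> \<open>Orthogonal decomposition of z P, which gives N = N' + |a|^2 N with N' >
    0.\<close>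
  moreover have "pCons 0 P = Q + smult (cnj a) (szego_star n P)"
    by (simp add: Q_def)
  ultimately have "of_real N = of_real N' + a * cnj a * of_real N"
    using QS ip_commute[of Q "szego_star n P"] ip_self[of Q] N
    by (simp add: ip_add_left ip_add_right ip_smult_left ip_smult_right N'_def mult_ac)
  also have "\<dots> = of_real (N' + (norm a)\<^sup>2 * N)"
    by (simp only: of_real_add of_real_mult complex_norm_square)
  finally have "N = N' + (norm a)\<^sup>2 * N"
    by (simp only: of_real_eq_iff)
  with \<open>N' > 0\<close> have "(norm a)\<^sup>2 * N < 1 * N"
    by linarith
  hence "norm a < 1"
    using \<open>N > 0\<close> by (simp add: abs_square_less_1)
  thus ?thesis
    using Q unfolding Q_def by blast
qed

lemma Phi_eqI: "is_monic_OP M n P \<Longrightarrow> Phi M n = P"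
  unfolding Phi_def by (rule the_equality) (auto intro: is_monic_OP_unique)

text \<open>Existence comes from the recursion step instead of Gram-Schmidt; uniqueness identifies
  each new polynomial with the \<open>THE\<close> in \<open>Phi\<close>.\<close>

lemma is_monic_OP_Phi: "is_monic_OP M n (Phi M n)"
proof (induction n)
  case 0
  have "is_monic_OP M 0 1"
    by (simp add: is_monic_OP_def)
  thus ?case
    using Phi_eqI by metis
next
  case (Suc n)
  thus ?case
    using is_monic_OP_step Phi_eqI by metis
qed

text \<open>The constant coefficient of the reversed polynomial is 1, so the recursion determines
  its coefficient and the \<open>THE\<close> in \<open>verblunsky\<close> picks the one found
  above.\<close>

lemma verblunsky:
  shows norm_verblunsky_less: "norm (verblunsky M n) < 1"
    and Phi_Suc: "Phi M (Suc n) =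
      pCons 0 (Phi M n) - smult (cnj (verblunsky M n)) (szego_star n (Phi M n))"
proof -
  obtain a where a: "norm a < 1"
    "is_monic_OP M (Suc n) (pCons 0 (Phi M n) - smult (cnj a) (szego_star n (Phi M n)))"
    using is_monic_OP_step[OF is_monic_OP_Phi] by blast
  have "coeff (szego_star n (Phi M n)) 0 = 1"
    using is_monic_OP_Phi[of n] by (auto simp: coeff_szego_star is_monic_OP_def)
  hence "smult b (szego_star n (Phi M n)) = smult c (szego_star n (Phi M n)) \<longleftrightarrow> b = c" for b c
    by (metis coeff_smult mult.right_neutral)
  hence "verblunsky M n = a"
    unfolding verblunsky_def Phi_eqI[OF a(2)]
    by (intro the_equality) auto
  thus "norm (verblunsky M n) < 1" "Phi M (Suc n) =
      pCons 0 (Phi M n) - smult (cnj (verblunsky M n)) (szego_star n (Phi M n))"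
    using a Phi_eqI by auto
qed

text \<open>Makes the results on arbitrary coefficient sequences available for the measure.\<close>

lemma Phi_eq_szego_poly: "Phi M n = szego_poly (verblunsky M) n"
proof (induction n)
  case 0
  show ?case
    by (rule Phi_eqI) (simp add: is_monic_OP_def)
qed (simp add: Phi_Suc)

end

section \<open>Interlacing\<close>

theorem theorem1p2:
  fixes M :: "complex measure" and n :: nat and \<beta> :: complex and zs ws :: "complex list"
  assumes "nontrivial_circle_measure M"
    and "n \<ge> 1"
    and "\<beta> \<in> sphere 0 1"
    and "length zs = n" and "cyclically_ordered_zeros (Phi_para M n \<beta>) zs"
    and "length ws = n" and "cyclically_ordered_zeros (Psi_para M n (- \<beta>)) ws"
  shows "strictly_interlace zs ws"
proof -
  interpret circle_measure M
    by unfold_locales fact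
  obtain N where N: "n = Suc N"
    using \<open>n \<ge> 1\<close> by (cases n) auto
  define P where "P = Phi_para M n \<beta>"
  define Q where "Q = Psi_para M n (- \<beta>)"
  have P: "P = para N (szego_poly (verblunsky M) N) \<beta>"
    by (simp add: P_def N Phi_para_def para_def Phi_eq_szego_poly)
  have Q: "Q = para N (szego_poly (\<lambda>j. - verblunsky M j) N) (- \<beta>)"
    by (simp add: Q_def N Psi_para_def para_def Psi_def)
  have \<beta>: "norm \<beta> = 1"
    using assms(3) by simp
  have zs: "cyclically_ordered zs" "set zs = {z. poly P z = 0}"
    and ws: "cyclically_ordered ws" "set ws = {z. poly Q z = 0}"
    using assms(5,7) by (simp_all add: cyclically_ordered_zeros_def P_def Q_def)
  have sphere: "set zs \<subseteq> sphere 0 1"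
    using zs(1) by (simp add: cyclically_ordered_def)
  show ?thesis
  proof (cases "n = 1")
    \<comment> \<open>The only arc would run from a point to itself and is empty, so this case rests
      on Q being nonzero at the zero of P.\<close>
    case True
    have "zs ! 0 \<in> set zs" "ws ! 0 \<in> set ws"
      using assms(4,6) True by simp_all
    hence "norm (zs ! 0) = 1" "poly P (zs ! 0) = 0" "poly Q (ws ! 0) = 0"
      using sphere zs(2) ws(2) by auto
    moreover from this(1,2) have "poly Q (zs ! 0) \<noteq> 0"
      using para_zero_residue(1)[OF _ norm_verblunsky_less P Q] by blast
    ultimately have "ws ! 0 \<noteq> zs ! 0"
      by metis
    thus ?thesis
      using assms(4,6) True by (simp add: strictly_interlace_def)
  next
    case False
    hence "n \<ge> 2"
      using \<open>n \<ge> 1\<close> by simp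
    show ?thesis
    proof (rule strictly_interlaceI[OF zs(1) ws(1)])
      show "length ws = length zs" "2 \<le> length zs"
        using assms(4,6) \<open>n \<ge> 2\<close> by simp_all
    next
      fix j assume j: "j < length zs"
      define k where "k = Suc j mod length zs"
      have k: "k < length zs" "k \<noteq> j"
        using j \<open>n \<ge> 2\<close> assms(4) by (auto simp: k_def mod_Suc)
      have "zs ! j \<noteq> zs ! k"
        using zs(1) j k by (simp add: cyclically_ordered_def nth_eq_iff_index_eq)
      moreover have mem: "zs ! j \<in> set zs" "zs ! k \<in> set zs"
        using j k by simp_all
      moreover obtain s where s: "0 \<le> s" "s < 2 * pi" "zs ! j = cis s"
        using mem sphere by (metis subsetD unit_circle_cis)
      moreover obtain t where t: "0 \<le> t" "t < 2 * pi" "zs ! k = cis t"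
        using mem sphere by (metis subsetD unit_circle_cis)
      ultimately have "s \<noteq> t"
        by auto
      \<comment> \<open>Lifts the angle of the next zero by one turn if needed, so that the arc
        becomes an interval to the right of \<open>s\<close>.\<close>
      define t' where "t' = (if s < t then t else t + 2 * pi)"
      have t': "zs ! k = cis t'" "s < t'" "t' - s < 2 * pi"
        using s t \<open>s \<noteq> t\<close> by (auto simp: t'_def complex_eq_iff)
      have arc: "cis u \<in> circle_arc (zs ! j) (zs ! k)" if "s < u" "u < t'" for u
        unfolding s(3) t'(1) by (intro circle_arcI that t'(3))
      \<comment> \<open>Cyclic order excludes zeros of P from the arc between neighbours.\<close>
      have gap: "poly P (cis u) \<noteq> 0" if "s < u" "u < t'" for u
      proof
        assume "poly P (cis u) = 0"
        hence "cis u \<in> set zs"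
          by (simp add: zs(2))
        then obtain l where l: "l < length zs" "zs ! l = cis u"
          unfolding in_set_conv_nth by blast
        have "zs ! l \<notin> circle_arc (zs ! j) (zs ! k)"
          using zs(1) j l(1) by (simp add: cyclically_ordered_def k_def)
        thus False
          using arc[OF that] l(2) by simp
      qed
      have "poly P (cis s) = 0" "poly P (cis t') = 0"
        using mem unfolding zs(2) s(3) t'(1) by simp_all
      from zero_between_para_zeros[OF norm_verblunsky_less \<beta> P Q t'(2) this gap]
      obtain u where u: "s < u" "u < t'" "poly Q (cis u) = 0"
        by blast
      hence "cis u \<in> set ws" "cis u \<in> circle_arc (zs ! j) (zs ! k)"
        using arc by (simp_all add: ws(2))
      thus "\<exists>w\<in>set ws. w \<in> circle_arc (zs ! j) (zs ! (Suc j mod length zs))"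
        unfolding k_def ..
    qed
  qed
qed

end
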